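(* Let $(A,\cdot)$ be a left-symmetric algebra and suppose there is another left-symmetric algebra structure "$\circ$" on its dual space $A^*$. Then $(\mathcal G(A),\mathcal G(A^* ),L^*_\cdot,L^*_\circ)$ is a matched pair of Lie algebras if and only if $(A,A^*,\mathrm{ad}^*_\cdot,-R^*_\cdot,\mathrm{ad}^*_\circ,-R^*_\circ)$ is a matched pair of left-symmetric algebras.
   Context: All algebras are finite-dimensional over a field $\mathbf F$. A left-symmetric algebra is a vector space $A$ with a bilinear product satisfying $(xy)z-x(yz)=(yx)z-y(xz)$. Its sub-adjacent Lie algebra $\mathcal G(A)$ is $A$ with $[x,y]=xy-yx$. Write $L(x)y=xy$, $R(x)y=yx$, $\mathrm{ad}=L-R$; subscripts indicate the product used. For a linear map $\rho:A\to gl(V)$, define $\rho^*:A\to gl(V^* )$ by $\langle\rho^*(x)u^*,v\rangle=-\langle u^*,\rho(x)v\rangle$; this gives $L^*,R^*,\mathrm{ad}^*=L^*-R^*$. For $(A^*,\circ)$ these act on $A^{**}=A$. Matched pair of Lie algebras $(\mathcal G,\mathcal H,\rho,\mu)$: Lie algebras $\mathcal G,\mathcal H$ and representations $\rho:\mathcal G\to gl(\mathcal H)$, $\mu:\mathcal H\to gl(\mathcal G)$ with $\rho(x)[a,b]-[\rho(x)a,b]-[a,\rho(x)b]+\rho(\mu(a)x)b-\rho(\mu(b)x)a=0$ and $\mu(a)[x,y]-[\mu(a)x,y]-[x,\mu(a)y]+\mu(\rho(x)a)y-\mu(\rho(y)a)x=0$ for all $x,y\in\mathcal G$, $a,b\in\mathcal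 H$. Bimodule of a left-symmetric algebra $A$: a vector space $V$ with linear maps $S,T:A\to gl(V)$ such that $S(x)S(y)-S(xy)=S(y)S(x)-S(yx)$ and $S(x)T(y)-T(y)S(x)=T(xy)-T(y)T(x)$. Matched pair of left-symmetric algebras $(A,B,l_A,r_A,l_B,r_B)$, for left-symmetric algebras $(A,\cdot)$, $(B,\circ)$: $(l_A,r_A)$ is a bimodule of $A$ on $B$, $(l_B,r_B)$ is a bimodule of $B$ on $A$, and for all $x,y\in A$, $a,b\in B$: $r_A(x)[a,b]=r_A(l_B(b)x)a-r_A(l_B(a)x)b+a\circ(r_A(x)b)-b\circ(r_A(x)a)$; $l_A(x)(a\circ b)=-l_A(l_B(a)x-r_B(a)x)b+(l_A(x)a-r_A(x)a)\circ b+r_A(r_B(b)x)a+a\circ(l_A(x)b)$; $r_B(a)[x,y]=r_B(l_A(y)a)x-r_B(l_A(x)a)y+x\cdot(r_B(a)y)-y\cdot(r_B(a)x)$; $l_B(a)(x\cdot y)=-l_B(l_A(x)a-r_A(x)a)y+(l_B(a)x-r_B(a)x)\cdot y+r_B(r_A(y)a)x+x\cdot(l_B(a)y)$. *)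

theory Defs
  imports Complex_Main "HOL-Library.Function_Algebras"
begin

text \<open>
  A vector space over a field is a subspace \<open>V\<close> of a type carrying a \<^locale>\<open>vector_space\<close> structure.
  Working relative to a carrier makes the dual space, a set of functions, an instance of the same
  definitions. Maps between carriers are total functions whose values outside the
  carriers are never constrained.
\<close>

locale vector_space_on = vector_space scale
  for scale :: "'f::field \<Rightarrow> 'a::ab_group_add \<Rightarrow> 'a" +
  fixes V :: "'a set"
  assumes subspace_carrier: "subspace V"

locale fin_dim_vector_space_on = vector_space_on scale V
  for scale :: "'f::field \<Rightarrow> 'a::ab_group_add \<Rightarrow> 'a" and V +
  assumes finitely_spanned: "\<exists>B. finite B \<and> span B = V"

definition linear_map_on ::
  "('f::field \<Rightarrow> 'a::ab_group_add \<Rightarrow> 'a) \<Rightarrow> 'a set \<Rightarrow>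
   ('f \<Rightarrow> 'b::ab_group_add \<Rightarrow> 'b) \<Rightarrow> 'b set \<Rightarrow> ('a \<Rightarrow> 'b) \<Rightarrow> bool" where
  "linear_map_on s\<^sub>V V s\<^sub>W W f \<longleftrightarrow>
     (\<forall>x\<in>V. f x \<in> W) \<and>
     (\<forall>x\<in>V. \<forall>y\<in>V. f (x + y) = f x + f y) \<and>
     (\<forall>c. \<forall>x\<in>V. f (s\<^sub>V c x) = s\<^sub>W c (f x))"

text \<open>Bilinearity of \<open>f\<close> on \<open>V \<times> W\<close> with values in \<open>U\<close>. For \<open>U = W\<close> it says that
  \<open>f\<close> is a linear map from \<open>V\<close> to \<open>gl(W)\<close>.\<close>

definition bilinear_map_on ::
  "('f::field \<Rightarrow> 'a::ab_group_add \<Rightarrow> 'a) \<Rightarrow> 'a set \<Rightarrow>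
   ('f \<Rightarrow> 'b::ab_group_add \<Rightarrow> 'b) \<Rightarrow> 'b set \<Rightarrow>
   ('f \<Rightarrow> 'c::ab_group_add \<Rightarrow> 'c) \<Rightarrow> 'c set \<Rightarrow> ('a \<Rightarrow> 'b \<Rightarrow> 'c) \<Rightarrow> bool" where
  "bilinear_map_on s\<^sub>V V s\<^sub>W W s\<^sub>U U f \<longleftrightarrow>
     (\<forall>x\<in>V. linear_map_on s\<^sub>W W s\<^sub>U U (f x)) \<and>
     (\<forall>y\<in>W. linear_map_on s\<^sub>V V s\<^sub>U U (\<lambda>x. f x y))"

section \<open>Lie algebras\<close>

locale lie_algebra_on = fin_dim_vector_space_on scale G
  for scale :: "'f::field \<Rightarrow> 'a::ab_group_add \<Rightarrow> 'a" and G +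
  fixes br :: "'a \<Rightarrow> 'a \<Rightarrow> 'a"
  assumes bilinear_br: "bilinear_map_on scale G scale G scale G br"
    and br_self: "x \<in> G \<Longrightarrow> br x x = 0"
    and jacobi: "\<lbrakk>x \<in> G; y \<in> G; z \<in> G\<rbrakk> \<Longrightarrow> br x (br y z) + br y (br z x) + br z (br x y) = 0"

locale lie_representation_on =
  Lie: lie_algebra_on s\<^sub>G G br + Rep: vector_space_on s\<^sub>V V
  for s\<^sub>G :: "'f::field \<Rightarrow> 'a::ab_group_add \<Rightarrow> 'a" and G br
    and s\<^sub>V :: "'f \<Rightarrow> 'b::ab_group_add \<Rightarrow> 'b" and V +
  fixes \<rho> :: "'a \<Rightarrow> 'b \<Rightarrow> 'b"
  assumes linear_to_gl: "bilinear_map_on s\<^sub>G G s\<^sub>V V s\<^sub>V V \<rho>"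
    and rep_br: "\<lbrakk>x \<in> G; y \<in> G; v \<in> V\<rbrakk> \<Longrightarrow> \<rho> (br x y) v = \<rho> x (\<rho> y v) - \<rho> y (\<rho> x v)"

locale lie_matched_pair =
  G: lie_representation_on s\<^sub>G G br\<^sub>G s\<^sub>H H \<rho> + H: lie_representation_on s\<^sub>H H br\<^sub>H s\<^sub>G G \<mu>
  for s\<^sub>G :: "'f::field \<Rightarrow> 'a::ab_group_add \<Rightarrow> 'a" and G br\<^sub>G
    and s\<^sub>H :: "'f \<Rightarrow> 'b::ab_group_add \<Rightarrow> 'b" and H br\<^sub>H
    and \<rho> :: "'a \<Rightarrow> 'b \<Rightarrow> 'b" and \<mu> :: "'b \<Rightarrow> 'a \<Rightarrow> 'a" +
  assumes compat_\<rho>: "\<lbrakk>x \<in> G; a \<in> H; b \<in> H\<rbrakk> \<Longrightarrow>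
      \<rho> x (br\<^sub>H a b) - br\<^sub>H (\<rho> x a) b - br\<^sub>H a (\<rho> x b) + \<rho> (\<mu> a x) b - \<rho> (\<mu> b x) a = 0"
    and compat_\<mu>: "\<lbrakk>a \<in> H; x \<in> G; y \<in> G\<rbrakk> \<Longrightarrow>
      \<mu> a (br\<^sub>G x y) - br\<^sub>G (\<mu> a x) y - br\<^sub>G x (\<mu> a y) + \<mu> (\<rho> x a) y - \<mu> (\<rho> y a) x = 0"

section \<open>Left-symmetric algebras\<close>

locale left_symmetric_algebra_on = fin_dim_vector_space_on scale A
  for scale :: "'f::field \<Rightarrow> 'a::ab_group_add \<Rightarrow> 'a" and A +
  fixes m :: "'a \<Rightarrow> 'a \<Rightarrow> 'a"
  assumes bilinear_m: "bilinear_map_on scale A scale A scale A m"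
    and left_symmetric: "\<lbrakk>x \<in> A; y \<in> A; z \<in> A\<rbrakk> \<Longrightarrow>
      m (m x y) z - m x (m y z) = m (m y x) z - m y (m x z)"

definition commutator :: "('a::ab_group_add \<Rightarrow> 'a \<Rightarrow> 'a) \<Rightarrow> 'a \<Rightarrow> 'a \<Rightarrow> 'a" where
  "commutator m x y = m x y - m y x"

definition left_op :: "('a \<Rightarrow> 'a \<Rightarrow> 'a) \<Rightarrow> 'a \<Rightarrow> 'a \<Rightarrow> 'a" where
  "left_op m x y = m x y"

definition right_op :: "('a \<Rightarrow> 'a \<Rightarrow> 'a) \<Rightarrow> 'a \<Rightarrow> 'a \<Rightarrow> 'a" where
  "right_op m x y = m y x"

definition ad_op :: "('a::ab_group_add \<Rightarrow> 'a \<Rightarrow> 'a) \<Rightarrow> 'a \<Rightarrow> 'a \<Rightarrow> 'a" where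
  "ad_op m x y = left_op m x y - right_op m x y"

locale lsa_bimodule_on =
  Alg: left_symmetric_algebra_on s\<^sub>A A m + Rep: vector_space_on s\<^sub>V V
  for s\<^sub>A :: "'f::field \<Rightarrow> 'a::ab_group_add \<Rightarrow> 'a" and A m
    and s\<^sub>V :: "'f \<Rightarrow> 'b::ab_group_add \<Rightarrow> 'b" and V +
  fixes S T :: "'a \<Rightarrow> 'b \<Rightarrow> 'b"
  assumes linear_S: "bilinear_map_on s\<^sub>A A s\<^sub>V V s\<^sub>V V S"
    and linear_T: "bilinear_map_on s\<^sub>A A s\<^sub>V V s\<^sub>V V T"
    and bimodule_SS: "\<lbrakk>x \<in> A; y \<in> A; v \<in> V\<rbrakk> \<Longrightarrow>
      S x (S y v) - S (m x y) v = S y (S x v) - S (m y x) v"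
    and bimodule_ST: "\<lbrakk>x \<in> A; y \<in> A; v \<in> V\<rbrakk> \<Longrightarrow>
      S x (T y v) - T y (S x v) = T (m x y) v - T y (T x v)"

locale lsa_matched_pair =
  A: lsa_bimodule_on s\<^sub>A A m\<^sub>A s\<^sub>B B l\<^sub>A r\<^sub>A + B: lsa_bimodule_on s\<^sub>B B m\<^sub>B s\<^sub>A A l\<^sub>B r\<^sub>B
  for s\<^sub>A :: "'f::field \<Rightarrow> 'a::ab_group_add \<Rightarrow> 'a" and A m\<^sub>A
    and s\<^sub>B :: "'f \<Rightarrow> 'b::ab_group_add \<Rightarrow> 'b" and B m\<^sub>B
    and l\<^sub>A r\<^sub>A :: "'a \<Rightarrow> 'b \<Rightarrow> 'b" and l\<^sub>B r\<^sub>B :: "'b \<Rightarrow> 'a \<Rightarrow> 'a" +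
  assumes compat_r\<^sub>A: "\<lbrakk>x \<in> A; a \<in> B; b \<in> B\<rbrakk> \<Longrightarrow>
      r\<^sub>A x (commutator m\<^sub>B a b) =
        r\<^sub>A (l\<^sub>B b x) a - r\<^sub>A (l\<^sub>B a x) b + m\<^sub>B a (r\<^sub>A x b) - m\<^sub>B b (r\<^sub>A x a)"
    and compat_l\<^sub>A: "\<lbrakk>x \<in> A; a \<in> B; b \<in> B\<rbrakk> \<Longrightarrow>
      l\<^sub>A x (m\<^sub>B a b) =
        - l\<^sub>A (l\<^sub>B a x - r\<^sub>B a x) b + m\<^sub>B (l\<^sub>A x a - r\<^sub>A x a) b + r\<^sub>A (r\<^sub>B b x) a + m\<^sub>B a (l\<^sub>A x b)"
    and compat_r\<^sub>B: "\<lbrakk>a \<in> B; x \<in> A; y \<in> A\<rbrakk> \<Longrightarrow>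
      r\<^sub>B a (commutator m\<^sub>A x y) =
        r\<^sub>B (l\<^sub>A y a) x - r\<^sub>B (l\<^sub>A x a) y + m\<^sub>A x (r\<^sub>B a y) - m\<^sub>A y (r\<^sub>B a x)"
    and compat_l\<^sub>B: "\<lbrakk>a \<in> B; x \<in> A; y \<in> A\<rbrakk> \<Longrightarrow>
      l\<^sub>B a (m\<^sub>A x y) =
        - l\<^sub>B (l\<^sub>A x a - r\<^sub>A x a) y + m\<^sub>A (l\<^sub>B a x - r\<^sub>B a x) y + r\<^sub>B (r\<^sub>A y a) x + m\<^sub>A x (l\<^sub>B a y)"

section \<open>Dual spaces and dual maps\<close>

definition fun_scale :: "'f::field \<Rightarrow> ('a \<Rightarrow> 'f) \<Rightarrow> 'a \<Rightarrow> 'f" where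
  "fun_scale c u = (\<lambda>x. c * u x)"

lemma fun_scale_apply: "fun_scale c u x = c * u x"
  by (simp add: fun_scale_def)

text \<open>The value \<open>0\<close> outside \<open>V\<close> makes a linear functional on \<open>V\<close> a unique element of the
  function type.\<close>

definition dual_space :: "('f::field \<Rightarrow> 'a::ab_group_add \<Rightarrow> 'a) \<Rightarrow> 'a set \<Rightarrow> ('a \<Rightarrow> 'f) set" where
  "dual_space scale V = {u. linear_map_on scale V (*) UNIV u \<and> (\<forall>x. x \<notin> V \<longrightarrow> u x = 0)}"

text \<open>\<open>dual_map V \<rho>\<close> is \<open>\<rho>\<^sup>*\<close> for \<open>\<rho>\<close> with values in \<open>gl(V)\<close>.\<close>

definition dual_map ::
  "'b set \<Rightarrow> ('a \<Rightarrow> 'b \<Rightarrow> 'b) \<Rightarrow> 'a \<Rightarrow> ('b \<Rightarrow> 'f::field) \<Rightarrow> 'b \<Rightarrow> 'f" where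
  "dual_map V \<rho> x u = (\<lambda>v. if v \<in> V then - u (\<rho> x v) else 0)"

definition evaluation ::
  "('f::field \<Rightarrow> 'a::ab_group_add \<Rightarrow> 'a) \<Rightarrow> 'a set \<Rightarrow> 'a \<Rightarrow> ('a \<Rightarrow> 'f) \<Rightarrow> 'f" where
  "evaluation scale V x = (\<lambda>u. if u \<in> dual_space scale V then u x else 0)"

text \<open>For \<open>\<rho>\<close> with values in \<open>gl(V\<^sup>*)\<close>, \<open>bidual_map\<close> is \<open>\<rho>\<^sup>*\<close>, which has values in
  \<open>gl(V\<^sup>*\<^sup>*)\<close>, transported to \<open>gl(V)\<close> along the canonical isomorphism \<open>V \<cong> V\<^sup>*\<^sup>*\<close> (see
  \<open>bij_betw_evaluation\<close> below).\<close>

definition bidual_map ::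
  "('f::field \<Rightarrow> 'a::ab_group_add \<Rightarrow> 'a) \<Rightarrow> 'a set \<Rightarrow>
   ('b \<Rightarrow> ('a \<Rightarrow> 'f) \<Rightarrow> 'a \<Rightarrow> 'f) \<Rightarrow> 'b \<Rightarrow> 'a \<Rightarrow> 'a" where
  "bidual_map scale V \<rho> a x =
     the_inv_into V (evaluation scale V)
       (dual_map (dual_space scale V) \<rho> a (evaluation scale V x))"

lemma (in fin_dim_vector_space_on) bij_betw_evaluation:
  "bij_betw (evaluation scale V) V (dual_space fun_scale (dual_space scale V))"
proof -
  obtain C where C: "finite C" "span C = V" using finitely_spanned by blast
  obtain B where B: "B \<subseteq> C" "independent B" "span B = V"
    by (metis C(2) maximal_independent_subset span_mono span_subspace subset_antisym span_superset
        order_trans subspace_span)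
  have finB: "finite B" using B(1) C(1) finite_subset by blast
  have sub: "B \<subseteq> V" using B(3) span_superset by blast
  define cb where "cb b = (\<lambda>x. if x \<in> V then representation B x b else 0)" for b
  have clos: "x + y \<in> V" "scale c x \<in> V" if "x \<in> V" "y \<in> V" for x y c
    using that subspace_carrier by (auto intro: subspace_add subspace_scale)
  have cb: "cb b \<in> dual_space scale V" for b
    unfolding dual_space_def linear_map_on_def cb_def
    using B clos by (auto simp: representation_add representation_scale)
  have expand: "(\<Sum>b\<in>B. scale (cb b x) b) = x" if "x \<in> V" for x
    using sum_representation_eq[OF B(2), of x B] B(3) finB that by (simp add: cb_def)
  have dsum: "u (\<Sum>b\<in>S. scale (k b) b) = (\<Sum>b\<in>S. k b * u b)"
    if u: "u \<in> dual_space scale V" and "S \<subseteq> B" for u k S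
  proof -
    have "finite S" using that finB finite_subset by blast
    then show ?thesis using \<open>S \<subseteq> B\<close>
    proof (induction S)
      case empty
      have "u (scale 0 0) = 0 * u 0"
        using u subspace_0[OF subspace_carrier] unfolding dual_space_def linear_map_on_def by blast
      then show ?case by simp
    next
      case (insert b S)
      have "(\<Sum>b\<in>S. scale (k b) b) \<in> V"
        using insert sub by (intro subspace_sum subspace_carrier) (auto intro: clos)
      then show ?case using insert sub u clos
        unfolding dual_space_def linear_map_on_def by auto
    qed
  qed
  have dual_expand: "(\<Sum>b\<in>B. fun_scale (u b) (cb b)) = u" if u: "u \<in> dual_space scale V" for u
  proof
    fix x
    have ap: "(\<Sum>b\<in>S. fun_scale (u b) (cb b)) x = (\<Sum>b\<in>S. cb b x * u b)" if "finite S" for S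
      using that by (induction S) (auto simp: fun_scale_def mult.commute)
    show "(\<Sum>b\<in>B. fun_scale (u b) (cb b)) x = u x"
    proof (cases "x \<in> V")
      case True
      then show ?thesis using dsum[OF u order_refl, of "\<lambda>b. cb b x"] expand ap finB by simp
    next
      case False
      then show ?thesis using ap[OF finB] u by (simp add: cb_def dual_space_def)
    qed
  qed
  have dadd: "u + v \<in> dual_space scale V" "fun_scale c u \<in> dual_space scale V"
    if "u \<in> dual_space scale V" "v \<in> dual_space scale V" for u v c
    using that unfolding dual_space_def linear_map_on_def fun_scale_def
    by (auto simp: algebra_simps)
  have d0: "0 \<in> dual_space scale V"
    unfolding dual_space_def linear_map_on_def by auto
  have psum: "(\<Sum>b\<in>S. fun_scale (k b) (cb b)) \<in> dual_space scale V \<and>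
      p (\<Sum>b\<in>S. fun_scale (k b) (cb b)) = (\<Sum>b\<in>S. k b * p (cb b))"
    if p: "p \<in> dual_space fun_scale (dual_space scale V)" and "finite S" for p k S
    using \<open>finite S\<close>
  proof (induction S)
    case empty
    have "p (fun_scale 0 0) = 0 * p 0"
      using p d0 unfolding dual_space_def[of fun_scale] linear_map_on_def by blast
    moreover have "fun_scale 0 0 = (0 :: 'a \<Rightarrow> 'f)" by (auto simp: fun_scale_def)
    ultimately show ?case using d0 by (simp add: zero_fun_def)
  next
    case (insert b S)
    let ?u = "fun_scale (k b) (cb b)" and ?v = "\<Sum>b\<in>S. fun_scale (k b) (cb b)"
    have u: "?u \<in> dual_space scale V" using dadd(2) cb by blast
    have v: "?v \<in> dual_space scale V" "p ?v = (\<Sum>b\<in>S. k b * p (cb b))"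
      using insert by blast+
    have "p (?u + ?v) = p ?u + p ?v" "p ?u = k b * p (cb b)"
      using p u v(1) cb unfolding dual_space_def[of fun_scale] linear_map_on_def by blast+
    moreover have "(\<Sum>b\<in>insert b S. fun_scale (k b) (cb b)) = ?u + ?v"
      using insert.hyps by (rule sum.insert)
    moreover have "(\<Sum>b\<in>insert b S. k b * p (cb b)) = k b * p (cb b) + (\<Sum>b\<in>S. k b * p (cb b))"
      using insert.hyps by (rule sum.insert)
    ultimately show ?case
      using dadd(1)[OF u v(1)] v(2) by presburger
  qed
  show ?thesis
  proof (rule bij_betw_imageI)
    show "inj_on (evaluation scale V) V"
    proof
      fix x y assume xy: "x \<in> V" "y \<in> V" "evaluation scale V x = evaluation scale V y"
      have "cb b x = cb b y" for b
        using fun_cong[OF xy(3), of "cb b"] cb by (simp add: evaluation_def)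
      then have "(\<Sum>b\<in>B. scale (cb b x) b) = (\<Sum>b\<in>B. scale (cb b y) b)" by simp
      then show "x = y" using expand xy(1,2) by simp
    qed
    show "evaluation scale V ` V = dual_space fun_scale (dual_space scale V)"
    proof (intro equalityI subsetI)
      fix p assume "p \<in> evaluation scale V ` V"
      then show "p \<in> dual_space fun_scale (dual_space scale V)"
        by (auto simp: dual_space_def[of fun_scale] linear_map_on_def evaluation_def dadd
              fun_scale_apply)
    next
      fix p assume p: "p \<in> dual_space fun_scale (dual_space scale V)"
      define x where "x = (\<Sum>b\<in>B. scale (p (cb b)) b)"
      have x: "x \<in> V" unfolding x_def
        using sub by (intro subspace_sum subspace_carrier) (auto intro: clos)
      have "evaluation scale V x u = p u" for u
      proof (cases "u \<in> dual_space scale V")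
        case True
        have "p u = (\<Sum>b\<in>B. u b * p (cb b))"
          using psum[OF p finB, of u] dual_expand[OF True] by simp
        also have "\<dots> = u x"
          unfolding x_def using dsum[OF True order_refl] by (simp add: mult.commute)
        finally show ?thesis using True by (simp add: evaluation_def)
      next
        case False
        then show ?thesis using p by (simp add: evaluation_def dual_space_def[of fun_scale])
      qed
      then show "p \<in> evaluation scale V ` V" using x by (metis ext image_eqI)
    qed
  qed
qed

end

theory Submission
  imports Defs
begin

text \<open>
  The representation axioms hold on both sides for all left-symmetric products, so only the
  compatibility conditions matter. Pair each of them with an element of the other space and move
  all operators onto \<open>A\<close>. Then \<open>compat_\<rho>\<close> becomes \<open>compat_r\<^sub>A\<close> with the roles of \<open>x\<close> and the test
  element exchanged, and \<open>compat_\<mu>\<close> tested against \<open>b\<close> becomes \<open>compat_l\<^sub>A\<close> tested against \<open>y\<close>.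
  The conditions on \<open>r\<^sub>B\<close> and \<open>l\<^sub>B\<close> follow in the same way by exchanging \<open>A\<close> and \<open>A\<^sup>*\<close>.
\<close>

section \<open>Bilinear maps on carriers\<close>

lemma bilinear_map_onD:
  assumes "bilinear_map_on sV V sW W sU U f"
  shows "\<lbrakk>x \<in> V; y \<in> W\<rbrakk> \<Longrightarrow> f x y \<in> U"
    and "\<lbrakk>x \<in> V; x' \<in> V; y \<in> W\<rbrakk> \<Longrightarrow> f (x + x') y = f x y + f x' y"
    and "\<lbrakk>x \<in> V; y \<in> W; y' \<in> W\<rbrakk> \<Longrightarrow> f x (y + y') = f x y + f x y'"
    and "\<lbrakk>x \<in> V; y \<in> W\<rbrakk> \<Longrightarrow> f (sV c x) y = sU c (f x y)"
    and "\<lbrakk>x \<in> V; y \<in> W\<rbrakk> \<Longrightarrow> f x (sW c y) = sU c (f x y)"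
  using assms by (auto simp: bilinear_map_on_def linear_map_on_def)

lemma bilinear_map_on_flip:
  "bilinear_map_on sV V sW W sU U f \<Longrightarrow> bilinear_map_on sW W sV V sU U (\<lambda>y x. f x y)"
  by (simp add: bilinear_map_on_def)

lemma (in vector_space_on) carrier_closed:
  shows "0 \<in> V"
    and "\<lbrakk>x \<in> V; y \<in> V\<rbrakk> \<Longrightarrow> x + y \<in> V"
    and "\<lbrakk>x \<in> V; y \<in> V\<rbrakk> \<Longrightarrow> x - y \<in> V"
    and "x \<in> V \<Longrightarrow> - x \<in> V"
    and "x \<in> V \<Longrightarrow> scale c x \<in> V"
  using subspace_carrier by (auto intro: subspace_0 subspace_add subspace_diff subspace_neg subspace_scale)

lemma bilinear_map_on_diff:
  assumes "vector_space_on sV V" "vector_space_on sW W"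
    and f: "bilinear_map_on sV V sW W sU U f"
  shows "\<lbrakk>x \<in> V; x' \<in> V; y \<in> W\<rbrakk> \<Longrightarrow> f (x - x') y = f x y - f x' y"
    and "\<lbrakk>x \<in> V; y \<in> W; y' \<in> W\<rbrakk> \<Longrightarrow> f x (y - y') = f x y - f x y'"
    and "\<lbrakk>x \<in> V; y \<in> W\<rbrakk> \<Longrightarrow> f (- x) y = - f x y"
    and "\<lbrakk>x \<in> V; y \<in> W\<rbrakk> \<Longrightarrow> f x (- y) = - f x y"
    and "y \<in> W \<Longrightarrow> f 0 y = 0"
    and "x \<in> V \<Longrightarrow> f x 0 = 0"
proof -
  interpret V: vector_space_on sV V by fact
  interpret W: vector_space_on sW W by fact
  note D = bilinear_map_onD[OF f]
  show d1: "f (x - x') y = f x y - f x' y" if "x \<in> V" "x' \<in> V" "y \<in> W" for x x' y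
    using D(2)[of "x - x'" x' y] that V.carrier_closed by (simp add: algebra_simps)
  show d2: "f x (y - y') = f x y - f x y'" if "x \<in> V" "y \<in> W" "y' \<in> W" for x y y'
    using D(3)[of x "y - y'" y'] that W.carrier_closed by (simp add: algebra_simps)
  show z1: "f 0 y = 0" if "y \<in> W" for y
    using d1[of 0 0 y] that V.carrier_closed by simp
  show z2: "f x 0 = 0" if "x \<in> V" for x
    using d2[of x 0 0] that W.carrier_closed by simp
  show "f (- x) y = - f x y" if "x \<in> V" "y \<in> W" for x y
    using d1[of 0 x y] z1 that V.carrier_closed by simp
  show "f x (- y) = - f x y" if "x \<in> V" "y \<in> W" for x y
    using d2[of x 0 y] z2 that W.carrier_closed by simp
qed

section \<open>The sub-adjacent Lie algebra\<close>

context left_symmetric_algebra_on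
begin

lemmas mult_closed = bilinear_map_onD(1)[OF bilinear_m]

lemmas mult_bilinear = bilinear_map_onD(2-5)[OF bilinear_m]
  bilinear_map_on_diff[OF vector_space_on_axioms vector_space_on_axioms bilinear_m]

lemma bilinear_commutator:
  "bilinear_map_on scale A scale A scale A (commutator m)"
  unfolding bilinear_map_on_def linear_map_on_def commutator_def
  by (simp add: carrier_closed mult_closed mult_bilinear scale_right_diff_distrib)

lemma lie_algebra_commutator: "lie_algebra_on scale A (commutator m)"
proof
  show "bilinear_map_on scale A scale A scale A (commutator m)"
    by (rule bilinear_commutator)
  show "commutator m x x = 0" for x
    by (simp add: commutator_def)
  show "commutator m x (commutator m y z) + commutator m y (commutator m z x)
      + commutator m z (commutator m x y) = 0" if "x \<in> A" "y \<in> A" "z \<in> A" for x y z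
  proof -
    \<comment> \<open>\<open>E\<close> is the left-symmetry defect, the associator of a, b, c minus
      that of b, a, c. The Jacobi sum expands to minus the sum of \<open>E\<close> over the cyclic
      permutations, so it vanishes term by term.\<close>
    define E where "E a b c = (m (m a b) c - m a (m b c)) - (m (m b a) c - m b (m a c))" for a b c
    have "commutator m x (commutator m y z) + commutator m y (commutator m z x)
        + commutator m z (commutator m x y) = - (E x y z + E y z x + E z x y)"
      using that
      by (simp add: commutator_def E_def carrier_closed mult_closed mult_bilinear algebra_simps)
    also have "\<dots> = 0"
      using left_symmetric that by (simp add: E_def)
    finally show ?thesis .
  qed
qed

lemma bilinear_ops:
  "bilinear_map_on scale A scale A scale A (left_op m)"
  "bilinear_map_on scale A scale A scale A (right_op m)"
  "bilinear_map_on scale A scale A scale A (ad_op m)"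
  using bilinear_m bilinear_commutator
  by (simp_all add: bilinear_map_on_def left_op_def[abs_def] right_op_def[abs_def]
      ad_op_def[abs_def] commutator_def[abs_def])

end

section \<open>Coadjoint operators under a nondegenerate pairing\<close>

definition coadjoint_on ::
  "'a set \<Rightarrow> 'b set \<Rightarrow> ('a \<Rightarrow> 'b \<Rightarrow> 'f::field) \<Rightarrow> ('a \<Rightarrow> 'a \<Rightarrow> 'a) \<Rightarrow> ('a \<Rightarrow> 'b \<Rightarrow> 'b) \<Rightarrow> bool" where
  "coadjoint_on A B p \<rho> \<sigma> \<longleftrightarrow>
     (\<forall>x\<in>A. \<forall>b\<in>B. \<sigma> x b \<in> B \<and> (\<forall>y\<in>A. p y (\<sigma> x b) = - p (\<rho> x y) b))"

text \<open>Replaces the algebra and its dual by two algebras on an equal footing, so that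
  \<open>flip\<close> turns each result about \<open>A\<close> into one about \<open>B\<close>. The
  dual operators enter only through their adjointness relation \<open>coadjoint_on\<close>, which
  covers \<open>dual_map\<close> and, with the pairing reversed, \<open>bidual_map\<close>.\<close>

locale lsa_pairing =
  A: left_symmetric_algebra_on sA A mA + B: left_symmetric_algebra_on sB B mB
  for sA :: "'f::field \<Rightarrow> 'a::ab_group_add \<Rightarrow> 'a" and A mA
    and sB :: "'f \<Rightarrow> 'b::ab_group_add \<Rightarrow> 'b" and B mB +
  fixes p :: "'a \<Rightarrow> 'b \<Rightarrow> 'f"
    and lA rA dA :: "'a \<Rightarrow> 'b \<Rightarrow> 'b"
    and lB rB dB :: "'b \<Rightarrow> 'a \<Rightarrow> 'a"
  assumes bilinear_p: "bilinear_map_on sA A sB B (*) UNIV p"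
    and nondegenerate_A: "\<lbrakk>x \<in> A; \<And>b. b \<in> B \<Longrightarrow> p x b = 0\<rbrakk> \<Longrightarrow> x = 0"
    and nondegenerate_B: "\<lbrakk>b \<in> B; \<And>x. x \<in> A \<Longrightarrow> p x b = 0\<rbrakk> \<Longrightarrow> b = 0"
    and coadjoint_lA: "coadjoint_on A B p (left_op mA) lA"
    and coadjoint_rA: "coadjoint_on A B p (right_op mA) rA"
    and coadjoint_dA: "coadjoint_on A B p (ad_op mA) dA"
    and coadjoint_lB: "coadjoint_on B A (\<lambda>b x. p x b) (left_op mB) lB"
    and coadjoint_rB: "coadjoint_on B A (\<lambda>b x. p x b) (right_op mB) rB"
    and coadjoint_dB: "coadjoint_on B A (\<lambda>b x. p x b) (ad_op mB) dB"
begin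

lemma flip: "lsa_pairing sB B mB sA A mA (\<lambda>b x. p x b) lB rB dB lA rA dA"
  using A.left_symmetric_algebra_on_axioms B.left_symmetric_algebra_on_axioms
    bilinear_map_on_flip[OF bilinear_p] nondegenerate_A nondegenerate_B
    coadjoint_lA coadjoint_rA coadjoint_dA coadjoint_lB coadjoint_rB coadjoint_dB
  by (simp add: lsa_pairing_def lsa_pairing_axioms_def)

lemmas closed = A.carrier_closed B.carrier_closed A.mult_closed B.mult_closed

lemmas p_bilinear = bilinear_map_onD(2-5)[OF bilinear_p]
  bilinear_map_on_diff[OF A.vector_space_on_axioms B.vector_space_on_axioms bilinear_p]

lemma coadjoint_closed:
  "\<lbrakk>x \<in> A; b \<in> B\<rbrakk> \<Longrightarrow> lA x b \<in> B" "\<lbrakk>x \<in> A; b \<in> B\<rbrakk> \<Longrightarrow> rA x b \<in> B" "\<lbrakk>x \<in> A; b \<in> B\<rbrakk> \<Longrightarrow> dA x b \<in> B"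
  "\<lbrakk>x \<in> A; b \<in> B\<rbrakk> \<Longrightarrow> lB b x \<in> A" "\<lbrakk>x \<in> A; b \<in> B\<rbrakk> \<Longrightarrow> rB b x \<in> A" "\<lbrakk>x \<in> A; b \<in> B\<rbrakk> \<Longrightarrow> dB b x \<in> A"
  using coadjoint_lA coadjoint_rA coadjoint_dA coadjoint_lB coadjoint_rB coadjoint_dB
  by (auto simp: coadjoint_on_def)

lemma p_coadjoint:
  assumes "x \<in> A" "y \<in> A" "b \<in> B"
  shows "p y (lA x b) = - p (mA x y) b"
    and "p y (rA x b) = - p (mA y x) b"
    and "p y (dA x b) = p (mA y x) b - p (mA x y) b"
  using coadjoint_lA coadjoint_rA coadjoint_dA assms
  by (auto simp: coadjoint_on_def left_op_def right_op_def ad_op_def p_bilinear closed)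

lemma p_coadjoint':
  assumes "x \<in> A" "a \<in> B" "b \<in> B"
  shows "p (lB a x) b = - p x (mB a b)"
    and "p (rB a x) b = - p x (mB b a)"
    and "p (dB a x) b = p x (mB b a) - p x (mB a b)"
  using coadjoint_lB coadjoint_rB coadjoint_dB assms
  by (auto simp: coadjoint_on_def left_op_def right_op_def ad_op_def p_bilinear closed)

text \<open>Nondegeneracy turns identities between vectors into scalar identities. Those are
  comparable even when the vectors lie in different spaces.\<close>

lemma eq_B_iff:
  assumes "b \<in> B" "c \<in> B"
  shows "b = c \<longleftrightarrow> (\<forall>y\<in>A. p y b = p y c)"
proof
  assume *: "\<forall>y\<in>A. p y b = p y c"
  have "b - c = 0"
    by (rule nondegenerate_B) (use assms * in \<open>auto simp: closed p_bilinear\<close>)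
  then show "b = c" by simp
qed simp

lemma eq_A_iff:
  assumes "x \<in> A" "y \<in> A"
  shows "x = y \<longleftrightarrow> (\<forall>b\<in>B. p x b = p y b)"
  using lsa_pairing.eq_B_iff[OF flip assms] .

text \<open>Adjointness determines an operator uniquely under a nondegenerate pairing, so
  \<open>dA\<close>, a parameter of its own, inherits ad = L - R.\<close>

lemma dA_eq: "\<lbrakk>x \<in> A; b \<in> B\<rbrakk> \<Longrightarrow> dA x b = lA x b - rA x b"
  by (subst eq_B_iff) (auto simp: closed coadjoint_closed p_bilinear p_coadjoint)

lemma dB_eq: "\<lbrakk>x \<in> A; b \<in> B\<rbrakk> \<Longrightarrow> dB b x = lB b x - rB b x"
  using lsa_pairing.dA_eq[OF flip] .

text \<open>Linearity is no part of \<open>coadjoint_on\<close>: it follows because the pairing of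
  \<open>\<sigma> x b\<close> with any fixed y is linear in x and in b.\<close>

lemma coadjoint_bilinear:
  assumes \<rho>: "bilinear_map_on sA A sA A sA A \<rho>" and \<sigma>: "coadjoint_on A B p \<rho> \<sigma>"
  shows "bilinear_map_on sA A sB B sB B \<sigma>"
proof -
  have cl: "\<sigma> x b \<in> B" and co: "\<And>y. y \<in> A \<Longrightarrow> p y (\<sigma> x b) = - p (\<rho> x y) b"
    if "x \<in> A" "b \<in> B" for x b
    using \<sigma> that by (auto simp: coadjoint_on_def)
  note [simp] = cl co closed p_bilinear bilinear_map_onD[OF \<rho>]
  have "\<sigma> x (b + c) = \<sigma> x b + \<sigma> x c" if "x \<in> A" "b \<in> B" "c \<in> B" for x b c
    by (subst eq_B_iff) (use that in auto)
  moreover have "\<sigma> x (sB k b) = sB k (\<sigma> x b)" if "x \<in> A" "b \<in> B" for x k b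
    by (subst eq_B_iff) (use that in auto)
  moreover have "\<sigma> (x + y) b = \<sigma> x b + \<sigma> y b" if "x \<in> A" "y \<in> A" "b \<in> B" for x y b
    by (subst eq_B_iff) (use that in auto)
  moreover have "\<sigma> (sA k x) b = sB k (\<sigma> x b)" if "x \<in> A" "b \<in> B" for x k b
    by (subst eq_B_iff) (use that in auto)
  ultimately show ?thesis
    by (simp add: bilinear_map_on_def linear_map_on_def)
qed

lemmas bilinear_lA = coadjoint_bilinear[OF A.bilinear_ops(1) coadjoint_lA]
  and bilinear_rA = coadjoint_bilinear[OF A.bilinear_ops(2) coadjoint_rA]
  and bilinear_dA = coadjoint_bilinear[OF A.bilinear_ops(3) coadjoint_dA]

section \<open>Dual representations and bimodules\<close>

lemma lie_representation_lA: "lie_representation_on sA A (commutator mA) sB B lA"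
proof -
  interpret Lie: lie_algebra_on sA A "commutator mA" by (rule A.lie_algebra_commutator)
  show ?thesis
  proof
    show "bilinear_map_on sA A sB B sB B lA" by (rule bilinear_lA)
    fix x y v assume "x \<in> A" "y \<in> A" "v \<in> B"
    \<comment> \<open>Left symmetry applied to z says that L carries commutators to commutators.
      Passing to the negative transpose preserves this.\<close>
    moreover have "p (mA (mA x y) z) v - p (mA x (mA y z)) v
        = p (mA (mA y x) z) v - p (mA y (mA x z)) v" if "z \<in> A" for z
      using arg_cong[OF A.left_symmetric[of x y z], of "\<lambda>w. p w v"] calculation that
      by (simp add: p_bilinear closed)
    ultimately show "lA (commutator mA x y) v = lA x (lA y v) - lA y (lA x v)"
      by (subst eq_B_iff)
        (auto simp: commutator_def closed coadjoint_closed p_bilinear p_coadjoint A.mult_bilinear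
          algebra_simps)
  qed
qed

lemma lsa_bimodule_dA_rA: "lsa_bimodule_on sA A mA sB B dA (\<lambda>x u. - rA x u)"
proof
  show "bilinear_map_on sA A sB B sB B dA" by (rule bilinear_dA)
  show "bilinear_map_on sA A sB B sB B (\<lambda>x u. - rA x u)"
    using bilinear_rA by (simp add: bilinear_map_on_def linear_map_on_def closed B.scale_minus_right)
  fix x y v assume xyv: "x \<in> A" "y \<in> A" "v \<in> B"
  have ls: "p (mA (mA a b) c) v - p (mA a (mA b c)) v = p (mA (mA b a) c) v - p (mA b (mA a c)) v"
    if "a \<in> A" "b \<in> A" "c \<in> A" for a b c
    using arg_cong[OF A.left_symmetric[of a b c], of "\<lambda>w. p w v"] xyv that
    by (simp add: p_bilinear closed)
  show "dA x (dA y v) - dA (mA x y) v = dA y (dA x v) - dA (mA y x) v"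
    using xyv
  proof (subst eq_B_iff, goal_cases)
    case 3
    show ?case
    proof
      fix z assume z: "z \<in> A"
      \<comment> \<open>This axiom says that the dual of ad represents the commutator algebra, which
        is the Jacobi identity again: the same cyclic sum of left-symmetry defects, now paired with
        v.\<close>
      define E where "E a b c = (p (mA (mA a b) c) v - p (mA a (mA b c)) v)
        - (p (mA (mA b a) c) v - p (mA b (mA a c)) v)" for a b c
      have "p z (dA x (dA y v) - dA (mA x y) v) - p z (dA y (dA x v) - dA (mA y x) v)
          = E x y z + E y z x + E z x y"
        using xyv z
        by (simp add: E_def closed coadjoint_closed p_bilinear p_coadjoint A.mult_bilinear
            algebra_simps)
      also have "\<dots> = 0"
        using xyv z ls by (simp add: E_def)
      finally show "p z (dA x (dA y v) - dA (mA x y) v) = p z (dA y (dA x v) - dA (mA y x) v)"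
        by simp
    qed
  qed (auto simp: closed coadjoint_closed)
  \<comment> \<open>Tested against z, the identity reduces to left symmetry of x, z, y, with the
    test element in the middle.\<close>
  show "dA x (- rA y v) - - rA y (dA x v) = - rA (mA x y) v - - rA y (- rA x v)"
    using xyv
  proof (subst eq_B_iff, goal_cases)
    case 3
    show ?case
    proof
      fix z assume "z \<in> A"
      then show "p z (dA x (- rA y v) - - rA y (dA x v)) = p z (- rA (mA x y) v - - rA y (- rA x v))"
        using xyv ls[of x z y]
        by (simp add: closed coadjoint_closed p_bilinear p_coadjoint A.mult_bilinear algebra_simps)
    qed
  qed (auto simp: closed coadjoint_closed)
qed

section \<open>Equivalence of the compatibility conditions\<close>

text \<open>These rules move every operator coming from \<open>A\<close> out of a product in \<open>B\<close>; together with
  \<open>p_coadjoint\<close> they bring all compatibility conditions to a common normal form.\<close>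

lemma p_mult_coadjoint:
  assumes "x \<in> A" "y \<in> A" "a \<in> B" "b \<in> B"
  shows "p y (mB a (lA x b)) = p (mA x (lB a y)) b"
    and "p y (mB a (rA x b)) = p (mA (lB a y) x) b"
    and "p y (mB (lA x b) a) = p (mA x (rB a y)) b"
    and "p y (mB (rA x b) a) = p (mA (rB a y) x) b"
  using p_coadjoint(1)[of x "lB a y" b] p_coadjoint(2)[of x "lB a y" b]
    p_coadjoint(1)[of x "rB a y" b] p_coadjoint(2)[of x "rB a y" b]
    p_coadjoint'(1)[of y a "lA x b"] p_coadjoint'(1)[of y a "rA x b"]
    p_coadjoint'(2)[of y a "lA x b"] p_coadjoint'(2)[of y a "rA x b"] assms
  by (simp_all add: coadjoint_closed)

lemmas normalize = closed coadjoint_closed p_bilinear p_coadjoint p_coadjoint' p_mult_coadjoint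
  A.mult_bilinear B.mult_bilinear commutator_def

lemma compat_rA_iff_compat_\<rho>:
  "(\<forall>x\<in>A. \<forall>a\<in>B. \<forall>b\<in>B. - rA x (commutator mB a b) =
      - rA (dB b x) a - - rA (dB a x) b + mB a (- rA x b) - mB b (- rA x a)) \<longleftrightarrow>
   (\<forall>x\<in>A. \<forall>a\<in>B. \<forall>b\<in>B. lA x (commutator mB a b) - commutator mB (lA x a) b
      - commutator mB a (lA x b) + lA (lB a x) b - lA (lB b x) a = 0)"
  (is "?l \<longleftrightarrow> ?r")
proof -
  \<comment> \<open>\<open>E x y a b\<close> is the left side of \<open>compat_\<rho>\<close> at x,
    a, b paired with y. For \<open>compat_r\<^sub>A\<close> at x, right minus left side paired with
    y gives \<open>E y x a b\<close>, since dual right multiplication tests on the product of y and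
    x where \<open>lA\<close> tests on that of x and y.\<close>
  define E where "E x y a b = p (mA x y) (mB b a) - p (mA x y) (mB a b)
      + p (mA x (lB b y)) a - p (mA x (rB b y)) a + p (mA (lB b x) y) a
      - p (mA x (lB a y)) b + p (mA x (rB a y)) b - p (mA (lB a x) y) b" for x y a b
  have "?l \<longleftrightarrow> (\<forall>x\<in>A. \<forall>a\<in>B. \<forall>b\<in>B. \<forall>y\<in>A. E y x a b = 0)"
  proof (intro ball_cong refl)
    fix x a b assume *: "x \<in> A" "a \<in> B" "b \<in> B"
    show "- rA x (commutator mB a b) =
        - rA (dB b x) a - - rA (dB a x) b + mB a (- rA x b) - mB b (- rA x a)
      \<longleftrightarrow> (\<forall>y\<in>A. E y x a b = 0)"
      using * by (subst eq_B_iff) (auto simp: normalize E_def dA_eq dB_eq algebra_simps)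
  qed
  moreover have "?r \<longleftrightarrow> (\<forall>x\<in>A. \<forall>a\<in>B. \<forall>b\<in>B. \<forall>y\<in>A. E x y a b = 0)"
  proof (intro ball_cong refl)
    fix x a b assume *: "x \<in> A" "a \<in> B" "b \<in> B"
    show "lA x (commutator mB a b) - commutator mB (lA x a) b
      - commutator mB a (lA x b) + lA (lB a x) b - lA (lB b x) a = 0
      \<longleftrightarrow> (\<forall>y\<in>A. E x y a b = 0)"
      using * by (subst eq_B_iff) (auto simp: normalize E_def dA_eq dB_eq algebra_simps)
  qed
  ultimately show ?thesis by blast
qed

lemma compat_lA_iff_compat_\<mu>:
  "(\<forall>x\<in>A. \<forall>a\<in>B. \<forall>b\<in>B. dA x (mB a b) =
      - dA (dB a x - - rB a x) b + mB (dA x a - - rA x a) b + - rA (- rB b x) a + mB a (dA x b)) \<longleftrightarrow>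
   (\<forall>a\<in>B. \<forall>x\<in>A. \<forall>y\<in>A. lB a (commutator mA x y) - commutator mA (lB a x) y
      - commutator mA x (lB a y) + lB (lA x a) y - lB (lA y a) x = 0)"
  (is "?l \<longleftrightarrow> ?r")
proof -
  \<comment> \<open>\<open>E x y a b\<close> is right minus left side of
    \<open>compat_l\<^sub>A\<close> paired with y, and also minus the left side of
    \<open>compat_\<mu>\<close> paired with b. The differences l - r become \<open>lA\<close> and
    \<open>lB\<close>, because r is minus the dual of R and ad + R = L.\<close>
  define E where "E x y a b = p (mA x y) (mB a b) - p (mA y x) (mB a b)
      + p (mA (lB a x) y) b - p (mA y (lB a x)) b + p (mA x (lB a y)) b - p (mA (lB a y) x) b
      + p (mA x (rB b y)) a - p (mA y (rB b x)) a" for x y a b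
  have "?l \<longleftrightarrow> (\<forall>x\<in>A. \<forall>a\<in>B. \<forall>b\<in>B. \<forall>y\<in>A. E x y a b = 0)"
  proof (intro ball_cong refl)
    fix x a b assume *: "x \<in> A" "a \<in> B" "b \<in> B"
    show "dA x (mB a b) =
        - dA (dB a x - - rB a x) b + mB (dA x a - - rA x a) b + - rA (- rB b x) a + mB a (dA x b)
      \<longleftrightarrow> (\<forall>y\<in>A. E x y a b = 0)"
      using * by (subst eq_B_iff) (auto simp: normalize E_def dA_eq dB_eq algebra_simps)
  qed
  moreover have "?r \<longleftrightarrow> (\<forall>a\<in>B. \<forall>x\<in>A. \<forall>y\<in>A. \<forall>b\<in>B. E x y a b = 0)"
  proof (intro ball_cong refl)
    fix a x y assume *: "a \<in> B" "x \<in> A" "y \<in> A"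
    show "lB a (commutator mA x y) - commutator mA (lB a x) y
      - commutator mA x (lB a y) + lB (lA x a) y - lB (lA y a) x = 0
      \<longleftrightarrow> (\<forall>b\<in>B. E x y a b = 0)"
      using * by (subst eq_A_iff) (auto simp: normalize E_def dA_eq dB_eq algebra_simps)
  qed
  ultimately show ?thesis by blast
qed

theorem lie_matched_pair_iff_lsa_matched_pair:
  "lie_matched_pair sA A (commutator mA) sB B (commutator mB) lA lB \<longleftrightarrow>
   lsa_matched_pair sA A mA sB B mB dA (\<lambda>x u. - rA x u) dB (\<lambda>a x. - rB a x)"
proof -
  \<comment> \<open>Each Lie condition matches two conditions of the other kind:
    \<open>compat_\<rho>\<close> is equivalent to \<open>compat_r\<^sub>A\<close> and, after
    \<open>flip\<close>, to \<open>compat_l\<^sub>B\<close>. Likewise \<open>compat_\<mu>\<close> is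
    equivalent to \<open>compat_l\<^sub>A\<close> and to \<open>compat_r\<^sub>B\<close>.\<close>
  note compat = compat_rA_iff_compat_\<rho> compat_lA_iff_compat_\<mu>
    lsa_pairing.compat_rA_iff_compat_\<rho>[OF flip] lsa_pairing.compat_lA_iff_compat_\<mu>[OF flip]
  note rep = lie_representation_lA lsa_pairing.lie_representation_lA[OF flip]
    lsa_bimodule_dA_rA lsa_pairing.lsa_bimodule_dA_rA[OF flip]
  show ?thesis
    unfolding lie_matched_pair_def lie_matched_pair_axioms_def
      lsa_matched_pair_def lsa_matched_pair_axioms_def
    using rep compat by (smt (verit))
qed

end

section \<open>The canonical pairing with the dual space\<close>

lemma (in vector_space_on) coadjoint_dual_map:
  assumes \<rho>: "bilinear_map_on scale V scale V scale V \<rho>"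
  shows "coadjoint_on V (dual_space scale V) (\<lambda>x u. u x) \<rho> (dual_map V \<rho>)"
  using bilinear_map_onD[OF \<rho>]
  by (auto simp: coadjoint_on_def dual_map_def dual_space_def linear_map_on_def carrier_closed)

lemma (in fin_dim_vector_space_on) coadjoint_bidual_map:
  assumes dual: "vector_space_on fun_scale (dual_space scale V)"
    and \<rho>: "bilinear_map_on fun_scale (dual_space scale V) fun_scale (dual_space scale V)
      fun_scale (dual_space scale V) \<rho>"
  shows "coadjoint_on (dual_space scale V) V (\<lambda>u x. u x) \<rho> (bidual_map scale V \<rho>)"
  unfolding coadjoint_on_def
proof (intro ballI conjI)
  let ?D = "dual_space scale V" and ?ev = "evaluation scale V"
  fix a x assume a: "a \<in> ?D" and x: "x \<in> V"
  have "?ev x \<in> dual_space fun_scale ?D"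
    using bij_betw_evaluation x by (auto simp: bij_betw_def)
  then have "dual_map ?D \<rho> a (?ev x) \<in> dual_space fun_scale ?D"
    using vector_space_on.coadjoint_dual_map[OF dual \<rho>] a by (simp add: coadjoint_on_def)
  \<comment> \<open>Finite dimension enters here: evaluation is onto the bidual, so the transported
    functional comes from a vector and \<open>the_inv_into\<close> returns that vector.\<close>
  then have mem: "dual_map ?D \<rho> a (?ev x) \<in> ?ev ` V"
    using bij_betw_evaluation by (simp add: bij_betw_def)
  have inj: "inj_on ?ev V" using bij_betw_evaluation by (simp add: bij_betw_def)
  show "bidual_map scale V \<rho> a x \<in> V"
    unfolding bidual_map_def by (rule the_inv_into_into[OF inj mem subset_refl])
  fix b assume b: "b \<in> ?D"
  have "?ev (bidual_map scale V \<rho> a x) = dual_map ?D \<rho> a (?ev x)"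
    unfolding bidual_map_def by (rule f_the_inv_into_f[OF inj mem])
  from fun_cong[OF this, of b] show "b (bidual_map scale V \<rho> a x) = - \<rho> a b x"
    using a b bilinear_map_onD(1)[OF \<rho> a b] by (simp add: evaluation_def dual_map_def)
qed

theorem theorem3p8:
  fixes scale :: "'f::field \<Rightarrow> 'a::ab_group_add \<Rightarrow> 'a"
    and A :: "'a set"
    and dot :: "'a \<Rightarrow> 'a \<Rightarrow> 'a"
    and circ :: "('a \<Rightarrow> 'f) \<Rightarrow> ('a \<Rightarrow> 'f) \<Rightarrow> ('a \<Rightarrow> 'f)"
  assumes "left_symmetric_algebra_on scale A dot"
    and "left_symmetric_algebra_on fun_scale (dual_space scale A) circ"
  shows
    "lie_matched_pair
       scale A (commutator dot)
       fun_scale (dual_space scale A) (commutator circ)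
       (dual_map A (left_op dot))
       (bidual_map scale A (left_op circ))
     \<longleftrightarrow>
     lsa_matched_pair
       scale A dot
       fun_scale (dual_space scale A) circ
       (dual_map A (ad_op dot))
       (\<lambda>x u. - dual_map A (right_op dot) x u)
       (bidual_map scale A (ad_op circ))
       (\<lambda>a x. - bidual_map scale A (right_op circ) a x)"
proof -
  interpret A: left_symmetric_algebra_on scale A dot by fact
  interpret D: left_symmetric_algebra_on fun_scale "dual_space scale A" circ by fact
  note bidual = A.coadjoint_bidual_map[OF D.vector_space_on_axioms]
  interpret lsa_pairing scale A dot fun_scale "dual_space scale A" circ "\<lambda>x u. u x"
    "dual_map A (left_op dot)" "dual_map A (right_op dot)" "dual_map A (ad_op dot)"
    "bidual_map scale A (left_op circ)" "bidual_map scale A (right_op circ)"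
    "bidual_map scale A (ad_op circ)"
  proof
    show "bilinear_map_on scale A fun_scale (dual_space scale A) (*) UNIV (\<lambda>x u. u x)"
      by (auto simp: bilinear_map_on_def linear_map_on_def dual_space_def fun_scale_def)
    show "b = 0" if "b \<in> dual_space scale A" "\<And>x. x \<in> A \<Longrightarrow> b x = 0" for b
    proof
      \<comment> \<open>Outside \<open>A\<close> the functional is zero by the convention built into
        \<open>dual_space\<close>, so vanishing on \<open>A\<close> makes it the zero
        function.\<close>
      show "b x = 0 x" for x
        using that by (cases "x \<in> A") (auto simp: dual_space_def)
    qed
    show "x = 0" if x: "x \<in> A" "\<And>b. b \<in> dual_space scale A \<Longrightarrow> b x = 0" for x
    proof -
      \<comment> \<open>Nondegeneracy on this side is injectivity of evaluation: functionals cannot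
        tell x from 0.\<close>
      have "evaluation scale A x = evaluation scale A 0"
      proof
        fix b
        have "b 0 = 0" if "b \<in> dual_space scale A"
        proof -
          have "b (scale 0 0) = 0 * b 0"
            using that A.carrier_closed(1) unfolding dual_space_def linear_map_on_def by blast
          then show ?thesis by simp
        qed
        then show "evaluation scale A x b = evaluation scale A 0 b"
          using x(2) by (simp add: evaluation_def)
      qed
      then show ?thesis
        using A.bij_betw_evaluation x(1) A.carrier_closed(1) by (auto simp: bij_betw_def inj_on_def)
    qed
  qed (intro A.coadjoint_dual_map bidual A.bilinear_ops D.bilinear_ops)+
  show ?thesis
    by (rule lie_matched_pair_iff_lsa_matched_pair)
qed

end
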